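(* The map $\Delta^\gamma:\mathcal H^\gamma\to\mathcal H^\gamma\otimes\mathcal H^\alpha$ defined by $$\Delta^\gamma:=(\mathrm{Id}\otimes m^\alpha)\,(\delta^\gamma\otimes\sigma)\,\Delta^p_\gamma$$ is a right coaction of $\mathcal H^\alpha$ on $\mathcal H^\gamma$, i.e. it is coassociative with respect to $\Delta^\alpha$: $$(\Delta^\gamma\otimes\mathrm{Id})\,\Delta^\gamma=(\mathrm{Id}\otimes\Delta^\alpha)\,\Delta^\gamma .$$
   Context: All vector spaces and algebras are over $\mathbb C$. $Y=\bigcup_{n\ge0}Y_n$ is the set of planar binary trees, $Y_n$ being the trees with $n$ internal vertices; $|t|=n$ (the order) for $t\in Y_n$. $|$ denotes the unique tree of order $0$. $t\vee s$ is the tree obtained by grafting $t$ (left) and $s$ (right) on a new root; every tree other than $|$ is uniquely of the form $t^l\vee t^r$. $\mathbb CY$ is the vector space with basis $Y$, and $V:\mathbb CY\to\mathbb CY$ is the linear map $V(t)=|\vee t$. Over product: the associative product $/$ on $\mathbb CY$ given by $t/|=t$, $t/(s^l\vee s^r)=(t/s^l)\vee s^r$; unit $|$; $t\vee s=t/V(s)$; $(\mathbb CY,/)$ is the free associative algebra on the trees $V(t)$. On tensor products $/$ is applied componentwise. Linear maps $\widetilde\Delta,\widetilde\delta:\mathbb CY\to\mathbb CY\otimes\mathbb CY$ are defined by recursion on the order: $\widetilde\Delta(|)=\widetilde\delta(|)=|\otimes|$, $\ \widetilde\delta(V(t))=(V\otimes\mathrm{Id})\widetilde\delta(t)$, $\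 \widetilde\Delta(V(t))=|\otimes V(t)+\widetilde\delta(V(t))$, $\ \widetilde\Delta(t\vee s)=\widetilde\Delta(t)/\widetilde\Delta(V(s))$, $\ \widetilde\delta(t\vee s)=\widetilde\Delta(t)/\widetilde\delta(V(s))$. $\mathcal H^\alpha=\mathbb C[V(t),t\in Y]$ is the commutative polynomial algebra on the $V(t)$, identified with the abelianization of $(\mathbb CY,/)$ (unit $|$, product $m^\alpha$ still written $/$), with quotient map $\pi:\mathbb CY\to\mathcal H^\alpha$; it is a Hopf algebra with coproduct the algebra morphism $\Delta^\alpha$ such that $\Delta^\alpha(V(t))=(\pi\otimes\pi)\widetilde\Delta(V(t))$. $\mathcal H^\gamma=\mathbb C\langle Y\rangle/(1-|)$ is the free associative algebra on the set of trees with $|$ identified with the unit; its product is written by juxtaposition $t_1\ldots t_n$. It is a Hopf algebra with coproduct the algebra morphism $\Delta^p_\gamma$ given on trees by $\Delta^p_\gamma(t)=\sum_{t=t_1/t_2}t_1\otimes t_2$; equivalently $\Delta^p_\gamma(|)=|\otimes|$ and $\Delta^p_\gamma(t\vee s)=(t\vee s)\otimes|+\sum t_{(1)}\otimes (t_{(2)}\vee s)$, where $\Delta^p_\gamma(t)=\sum t_{(1)}\otimes t_{(2)}$. $\delta^\gamma:\mathcal H^\gamma\to\mathcal H^\gamma\otimes\mathcal H^\alpha$ is the algebra morphism given on single trees by $\delta^\gamma(t)=(\mathrm{Id}\otimes\pi)\widetilde\delta(t)$. $\sigma:\mathcal H^\gamma\to\mathcal H^\alpha$ is the algebra morphism $\sigma(t_1\ldots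 t_n)=\pi(t_1/\cdots/t_n)$. *)

theory Defs
  imports Complex_Main "HOL-Library.Multiset" "HOL-Library.Product_Plus" "HOL-Library.Poly_Mapping"
begin

text \<open>
  All vector spaces come with a distinguished basis \<open>'b\<close> and are represented as the finitely supported
  functions \<^typ>\<open>'b \<Rightarrow>\<^sub>0 complex\<close>.  If the basis is a monoid (written additively), the product of
  \<^theory>\<open>HOL-Library.Poly_Mapping\<close> is the convolution product, i.e. the bilinear extension of the
  monoid operation: \<^typ>\<open>'b \<Rightarrow>\<^sub>0 complex\<close> is the monoid algebra of \<open>'b\<close>.

  The tensor product of the spaces with bases \<open>'a\<close> and \<open>'b\<close> is the space with basis \<open>'a \<times> 'b\<close>;
  since the monoid structure on \<open>'a \<times> 'b\<close> is componentwise, so is the product of tensors.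
\<close>

type_synonym 'b vec = "'b \<Rightarrow>\<^sub>0 complex"

definition basis :: "'b \<Rightarrow> 'b vec"
  where "basis b = Poly_Mapping.single b 1"

definition smul :: "complex \<Rightarrow> 'b vec \<Rightarrow> 'b vec"
  where "smul c x = Poly_Mapping.map ((*) c) x"

text \<open>The linear map with given values on the basis.\<close>

definition lin :: "('a \<Rightarrow> 'b vec) \<Rightarrow> 'a vec \<Rightarrow> 'b vec"
  where "lin f x = (\<Sum>a\<in>Poly_Mapping.keys x. smul (Poly_Mapping.lookup x a) (f a))"

definition tensor :: "'a vec \<Rightarrow> 'b vec \<Rightarrow> ('a \<times> 'b) vec"
  where "tensor u v = lin (\<lambda>a. lin (\<lambda>b. basis (a, b)) v) u"

text \<open>The map \<open>f \<otimes> g\<close>, for linear \<open>f\<close> and \<open>g\<close>.\<close>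

definition tensor_map :: "('a vec \<Rightarrow> 'c vec) \<Rightarrow> ('b vec \<Rightarrow> 'd vec) \<Rightarrow> ('a \<times> 'b) vec \<Rightarrow> ('c \<times> 'd) vec"
  where "tensor_map f g = lin (\<lambda>(a, b). tensor (f (basis a)) (g (basis b)))"

text \<open>The canonical isomorphism \<open>(A \<otimes> B) \<otimes> C \<rightarrow> A \<otimes> (B \<otimes> C)\<close>, usually suppressed on paper.\<close>

definition tensor_assoc :: "(('a \<times> 'b) \<times> 'c) vec \<Rightarrow> ('a \<times> ('b \<times> 'c)) vec"
  where "tensor_assoc = lin (\<lambda>((a, b), c). basis (a, (b, c)))"

text \<open>The multiplication of a monoid algebra, as a linear map on the tensor square.\<close>

definition mult_map :: "('a::monoid_add \<times> 'a) vec \<Rightarrow> 'a vec"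
  where "mult_map = lin (\<lambda>(a, b). basis a * basis b)"

lemma lookup_smul [simp]: "Poly_Mapping.lookup (smul c x) k = c * Poly_Mapping.lookup x k"
  by (simp add: smul_def Poly_Mapping.map.rep_eq when_def)

lemma lookup_sum_vec: "Poly_Mapping.lookup (\<Sum>a\<in>A. f a) k = (\<Sum>a\<in>A. Poly_Mapping.lookup (f a) k)"
  by (induction A rule: infinite_finite_induct) (auto simp: lookup_add)

lemma lin_superset:
  assumes "finite A" "Poly_Mapping.keys x \<subseteq> A"
  shows "lin f x = (\<Sum>a\<in>A. smul (Poly_Mapping.lookup x a) (f a))"
  unfolding lin_def using assms
  by (intro sum.mono_neutral_left) (auto simp: in_keys_iff intro!: poly_mapping_eqI)

lemma lin_add: "lin f (x + y) = lin f x + lin f y"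
proof -
  let ?A = "Poly_Mapping.keys x \<union> Poly_Mapping.keys y"
  have "lin f (x + y) = (\<Sum>a\<in>?A. smul (Poly_Mapping.lookup (x + y) a) (f a))"
    by (rule lin_superset) (auto dest: subsetD[OF Poly_Mapping.keys_add])
  also have "\<dots> = (\<Sum>a\<in>?A. smul (Poly_Mapping.lookup x a) (f a) + smul (Poly_Mapping.lookup y a) (f a))"
    by (intro sum.cong refl poly_mapping_eqI) (simp add: lookup_add algebra_simps)
  also have "\<dots> = lin f x + lin f y"
    by (simp add: sum.distrib lin_superset[of ?A x] lin_superset[of ?A y])
  finally show ?thesis .
qed

lemma lin_smul: "lin f (smul c x) = smul c (lin f x)"
proof -
  have "lin f (smul c x)
      = (\<Sum>a\<in>Poly_Mapping.keys x. smul (Poly_Mapping.lookup (smul c x) a) (f a))"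
    by (rule lin_superset) (auto simp: in_keys_iff)
  also have "\<dots> = smul c (lin f x)"
    by (intro poly_mapping_eqI)
      (simp add: lin_def lookup_sum_vec sum_distrib_left algebra_simps)
  finally show ?thesis .
qed

lemma lin_basis [simp]: "lin f (basis b) = f b"
  by (auto simp: lin_def basis_def intro!: poly_mapping_eqI)

lemma tensor_basis [simp]: "tensor (basis a) (basis b) = basis (a, b)"
  by (simp add: tensor_def)

lemma tensor_map_basis: "tensor_map f g (basis (a, b)) = tensor (f (basis a)) (g (basis b))"
  by (simp add: tensor_map_def)

lemma basis_mult: "basis a * basis b = basis (a + b)"
  by (simp add: basis_def mult_single)

lemma basis_zero: "basis 0 = 1"
  by (simp add: basis_def)


section \<open>Planar binary trees and the over product\<close>

datatype ptree = Leaf | Graft ptree ptree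

primrec over :: "ptree \<Rightarrow> ptree \<Rightarrow> ptree"
  where
    "over t Leaf = t"
  | "over t (Graft s1 s2) = Graft (over t s1) s2"

text \<open>
  The over product is the (noncommutative) monoid operation on trees; the product \<open>*\<close> on
  \<^typ>\<open>ptree vec\<close> is then its bilinear extension.
\<close>

instantiation ptree :: monoid_add
begin

definition zero_ptree :: ptree where "zero_ptree = Leaf"

definition plus_ptree :: "ptree \<Rightarrow> ptree \<Rightarrow> ptree" where "plus_ptree t s = over t s"

instance
proof
  fix a b c :: ptree
  show "a + b + c = a + (b + c)"
    unfolding plus_ptree_def by (induction c) auto
  show "0 + a = a"
    unfolding plus_ptree_def zero_ptree_def by (induction a) auto
  show "a + 0 = a"
    unfolding plus_ptree_def zero_ptree_def by simp
qed

end

lemma Graft_eq_over: "Graft t s = t + Graft Leaf s"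
  by (simp add: plus_ptree_def)

definition V :: "ptree vec \<Rightarrow> ptree vec"
  where "V = lin (\<lambda>t. basis (Graft Leaf t))"

fun Dtil_tree :: "ptree \<Rightarrow> (ptree \<times> ptree) vec"
  and dtil_tree :: "ptree \<Rightarrow> (ptree \<times> ptree) vec"
  where
    "Dtil_tree Leaf = tensor (basis Leaf) (basis Leaf)"
  | "Dtil_tree (Graft t s) =
       Dtil_tree t * (tensor (basis Leaf) (V (basis s)) + tensor_map V id (dtil_tree s))"
  | "dtil_tree Leaf = tensor (basis Leaf) (basis Leaf)"
  | "dtil_tree (Graft t s) = Dtil_tree t * tensor_map V id (dtil_tree s)"

definition Delta_tilde :: "ptree vec \<Rightarrow> (ptree \<times> ptree) vec"
  where "Delta_tilde = lin Dtil_tree"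

definition delta_tilde :: "ptree vec \<Rightarrow> (ptree \<times> ptree) vec"
  where "delta_tilde = lin dtil_tree"

text \<open>The recursion in its usual form.\<close>

lemma tensor_one: "tensor 1 1 = 1"
  by (simp add: zero_prod_def flip: basis_zero)

lemma basis_Leaf_Leaf: "basis (Leaf, Leaf) = 1"
  using basis_zero[where 'a = "ptree \<times> ptree"] by (simp add: zero_prod_def zero_ptree_def)

lemma Delta_delta_tilde_rec:
  "Delta_tilde (basis Leaf) = tensor (basis Leaf) (basis Leaf)"
  "delta_tilde (basis Leaf) = tensor (basis Leaf) (basis Leaf)"
  "delta_tilde (V (basis t)) = tensor_map V id (delta_tilde (basis t))"
  "Delta_tilde (V (basis t)) = tensor (basis Leaf) (V (basis t)) + delta_tilde (V (basis t))"
  "Delta_tilde (basis (Graft t s)) = Delta_tilde (basis t) * Delta_tilde (V (basis s))"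
  "delta_tilde (basis (Graft t s)) = Delta_tilde (basis t) * delta_tilde (V (basis s))"
  by (simp_all add: Delta_tilde_def delta_tilde_def V_def basis_Leaf_Leaf)


section \<open>The polynomial algebra on the trees \<open>V(t)\<close>\<close>

text \<open>
  The monomials are the finite multisets of generators, the multiset \<open>{#t\<^sub>1, \<dots>, t\<^sub>n#}\<close>
  standing for the monomial \<open>V(t\<^sub>1) \<dots> V(t\<^sub>n)\<close>.
\<close>

type_synonym H_alpha = "ptree multiset vec"

text \<open>The quotient map sends \<open>t \<or> s = t / V(s)\<close> to the product of the images of \<open>t\<close> and \<open>V(s)\<close>.\<close>

primrec pi_tree :: "ptree \<Rightarrow> ptree multiset"
  where
    "pi_tree Leaf = {#}"
  | "pi_tree (Graft t s) = pi_tree t + {#s#}"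

definition pi_ab :: "ptree vec \<Rightarrow> H_alpha"
  where "pi_ab = lin (\<lambda>t. basis (pi_tree t))"

lemma pi_tree_over: "pi_tree (t + s) = pi_tree t + pi_tree s"
  unfolding plus_ptree_def by (induction s) auto

text \<open>The algebra morphism with value \<open>f t\<close> on the generator \<open>V(t)\<close>.\<close>

definition alpha_lift :: "(ptree \<Rightarrow> 'b::comm_monoid_add vec) \<Rightarrow> H_alpha \<Rightarrow> 'b vec"
  where "alpha_lift f = lin (\<lambda>M. \<Prod>t\<in>#M. f t)"

definition Delta_alpha :: "H_alpha \<Rightarrow> (ptree multiset \<times> ptree multiset) vec"
  where "Delta_alpha = alpha_lift (\<lambda>t. tensor_map pi_ab pi_ab (Delta_tilde (V (basis t))))"

definition m_alpha :: "(ptree multiset \<times> ptree multiset) vec \<Rightarrow> H_alpha"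
  where "m_alpha = mult_map"


section \<open>The free algebra on trees with the trivial tree as unit\<close>

text \<open>
  The monomials are the words of trees in which all letters \<^const>\<open>Leaf\<close> have been deleted, that is,
  the normal forms for the congruence on words generated by identifying \<^const>\<open>Leaf\<close> with the
  empty word (see \<open>word_eq_iff\<close> below).
\<close>

typedef tword = "{w :: ptree list. Leaf \<notin> set w}"
  morphisms letters Abs_tword
  by (rule exI[of _ "[]"]) simp

setup_lifting type_definition_tword

lift_definition word :: "ptree list \<Rightarrow> tword" is "filter (\<lambda>t. t \<noteq> Leaf)"
  by simp

instantiation tword :: monoid_add
begin

lift_definition zero_tword :: tword is "[]" by simp

lift_definition plus_tword :: "tword \<Rightarrow> tword \<Rightarrow> tword" is "(@)" by simp

instance by (standard; transfer) simp_all

end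

type_synonym H_gamma = "tword vec"

lemma word_Nil: "word [] = 0"
  by transfer simp

lemma word_append: "word (u @ v) = word u + word v"
  by transfer simp

lemma word_Leaf: "word [Leaf] = 0"
  by transfer simp

lemma word_letters: "word (letters w) = w"
  by transfer (auto intro: filter_True)

lemma word_eq_iff:
  "word u = word v \<longleftrightarrow> equivclp (\<lambda>x y. \<exists>a b. x = a @ [Leaf] @ b \<and> y = a @ b) u v"
  (is "_ \<longleftrightarrow> equivclp ?R u v")
proof
  assume "equivclp ?R u v"
  then show "word u = word v"
  proof (induction rule: equivclp_induct)
    case (step y z)
    have "word (a @ [Leaf] @ b) = word (a @ b)" for a b
      by (simp only: word_append word_Leaf add_0_left)
    then show ?case
      using step by metis
  qed simp
next
  have app: "equivclp ?R (c @ x) (c @ y)" if "equivclp ?R x y" for c x y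
    using that
  proof (induction rule: equivclp_induct)
    case base
    show ?case by (rule equivclp_refl)
  next
    case (step y z)
    have "?R (c @ y) (c @ z) \<or> ?R (c @ z) (c @ y)"
      using step(2) by (metis append.assoc)
    then have "equivclp ?R (c @ y) (c @ z)"
      by (rule disjE) (rule r_into_equivclp, assumption, rule converse_r_into_equivclp, assumption)
    with step(3) show ?case
      by (rule equivclp_trans)
  qed
  have norm: "equivclp ?R x (filter (\<lambda>t. t \<noteq> Leaf) x)" for x
  proof (induction x)
    case Nil
    show ?case by (simp add: equivclp_refl)
  next
    case (Cons t x)
    show ?case
    proof (cases "t = Leaf")
      case True
      have "?R (t # x) x"
        using True by (intro exI[of _ "[]"] exI[of _ x]) simp
      then have "equivclp ?R (t # x) x"
        by (rule r_into_equivclp)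
      then show ?thesis
        using equivclp_trans[OF _ Cons] True by simp
    next
      case False
      then show ?thesis
        using app[OF Cons, of "[t]"] by simp
    qed
  qed
  assume "word u = word v"
  then have "filter (\<lambda>t. t \<noteq> Leaf) u = filter (\<lambda>t. t \<noteq> Leaf) v"
    by transfer
  then show "equivclp ?R u v"
    using norm[of u] equivclp_sym[OF norm[of v]] by (auto intro: equivclp_trans)
qed

definition tree_gamma :: "ptree \<Rightarrow> H_gamma"
  where "tree_gamma t = basis (word [t])"

text \<open>The linear inclusion of the span of all trees.\<close>

definition incl_gamma :: "ptree vec \<Rightarrow> H_gamma"
  where "incl_gamma = lin tree_gamma"

text \<open>The algebra morphism with value \<open>f t\<close> on each tree \<open>t\<close>; it requires \<open>f Leaf = 1\<close>.\<close>

definition gamma_lift :: "(ptree \<Rightarrow> 'b::monoid_add vec) \<Rightarrow> H_gamma \<Rightarrow> 'b vec"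
  where "gamma_lift f = lin (\<lambda>w. prod_list (map f (letters w)))"

definition Delta_p_tree :: "ptree \<Rightarrow> (tword \<times> tword) vec"
  where "Delta_p_tree t = (\<Sum>(t1, t2)\<in>{(t1, t2). t = over t1 t2}. tensor (tree_gamma t1) (tree_gamma t2))"

definition Delta_p_gamma :: "H_gamma \<Rightarrow> (tword \<times> tword) vec"
  where "Delta_p_gamma = gamma_lift Delta_p_tree"

definition delta_gamma_tree :: "ptree \<Rightarrow> (tword \<times> ptree multiset) vec"
  where "delta_gamma_tree t = tensor_map incl_gamma pi_ab (delta_tilde (basis t))"

definition delta_gamma :: "H_gamma \<Rightarrow> (tword \<times> ptree multiset) vec"
  where "delta_gamma = gamma_lift delta_gamma_tree"

definition sigma :: "H_gamma \<Rightarrow> H_alpha"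
  where "sigma = gamma_lift (\<lambda>t. pi_ab (basis t))"

definition Delta_gamma :: "H_gamma \<Rightarrow> (tword \<times> ptree multiset) vec"
  where "Delta_gamma =
    tensor_map id m_alpha \<circ> tensor_assoc \<circ> tensor_map delta_gamma sigma \<circ> Delta_p_gamma"


section \<open>The defining properties of these maps\<close>

lemma lin_zero [simp]: "lin f 0 = 0"
  by (simp add: lin_def)

lemma lin_sum: "lin f (\<Sum>a\<in>A. g a) = (\<Sum>a\<in>A. lin f (g a))"
  by (induction A rule: infinite_finite_induct) (auto simp: lin_add)

lemma vec_expand: "x = (\<Sum>a\<in>Poly_Mapping.keys x. smul (Poly_Mapping.lookup x a) (basis a))"
  by (rule poly_mapping_eqI)
    (auto simp: lookup_sum_vec basis_def lookup_single when_def in_keys_iff if_distrib sum.delta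
      cong: if_cong)

lemma smul_conv_mult: "smul c (x :: 'a::monoid_add vec) = Poly_Mapping.single 0 c * x"
  by (simp add: smul_def mult_map_scale_conv_mult)

lemma single_zero_commute:
  "(x :: 'a::monoid_add vec) * Poly_Mapping.single 0 c = Poly_Mapping.single 0 c * x"
proof -
  have "basis a * Poly_Mapping.single 0 c = Poly_Mapping.single 0 c * basis a" for a :: 'a
    by (simp add: basis_def mult_single)
  moreover have "smul d u * v = smul d (u * v)" for d and u v :: "'a vec"
    by (simp add: smul_conv_mult mult.assoc)
  moreover have "Poly_Mapping.single 0 c * smul d u = smul d (Poly_Mapping.single 0 c * u)" for d and u :: "'a vec"
    by (simp add: smul_conv_mult mult_single mult.commute flip: mult.assoc)
  ultimately have "(\<Sum>a\<in>A. smul (d a) (basis a)) * Poly_Mapping.single 0 c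
      = Poly_Mapping.single 0 c * (\<Sum>a\<in>A. smul (d a) (basis a))" for A :: "'a set" and d
    by (simp add: sum_distrib_left sum_distrib_right)
  from this[of "Poly_Mapping.lookup x" "Poly_Mapping.keys x"] show ?thesis
    by (simp only: vec_expand[symmetric])
qed

lemma smul_mult_smul: "smul c x * smul d y = smul (c * d) (x * (y :: 'a::monoid_add vec))"
proof -
  have "smul c x * smul d y = Poly_Mapping.single 0 c * (x * Poly_Mapping.single 0 d) * y"
    by (simp add: smul_conv_mult mult.assoc)
  also have "\<dots> = (Poly_Mapping.single 0 c * Poly_Mapping.single 0 d) * (x * y)"
    by (simp only: single_zero_commute[of x] mult.assoc)
  also have "\<dots> = smul (c * d) (x * y)"
    by (simp add: smul_conv_mult mult_single)
  finally show ?thesis .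
qed

lemma lin_mult:
  fixes f :: "'a::monoid_add \<Rightarrow> 'b::monoid_add vec"
  assumes "\<And>a b. f (a + b) = f a * f b"
  shows "lin f (x * y) = lin f x * lin f y"
proof -
  let ?c = Poly_Mapping.lookup
  have "lin f (x * y) = lin f ((\<Sum>a\<in>Poly_Mapping.keys x. smul (?c x a) (basis a)) *
      (\<Sum>b\<in>Poly_Mapping.keys y. smul (?c y b) (basis b)))"
    by (simp only: vec_expand[symmetric])
  also have "\<dots> = (\<Sum>a\<in>Poly_Mapping.keys x. \<Sum>b\<in>Poly_Mapping.keys y. smul (?c x a * ?c y b) (f a * f b))"
    by (simp add: sum_product smul_mult_smul basis_mult lin_sum lin_smul assms)
  also have "\<dots> = lin f x * lin f y"
    by (simp add: lin_def sum_product smul_mult_smul)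
  finally show ?thesis .
qed

lemma pi_ab_morphism:
  "pi_ab (basis Leaf) = 1"
  "pi_ab (V (basis t)) = basis {#t#}"
  "pi_ab (x * y) = pi_ab x * pi_ab y"
  unfolding pi_ab_def V_def
  by (simp add: basis_zero flip: zero_multiset_def, simp)
    (rule lin_mult, simp add: pi_tree_over basis_mult)

lemma alpha_lift_morphism:
  "alpha_lift f 1 = 1"
  "alpha_lift f (basis {#t#}) = f t"
  "alpha_lift f (x * y) = alpha_lift f x * alpha_lift f y"
  unfolding alpha_lift_def
  by (simp flip: basis_zero, simp) (rule lin_mult, simp)

lemma letters_word: "letters (word u) = filter (\<lambda>t. t \<noteq> Leaf) u"
  by transfer simp

lemma gamma_lift_morphism:
  "gamma_lift f 1 = 1"
  "gamma_lift f (x * y) = gamma_lift f x * gamma_lift f y"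
  "f Leaf = 1 \<Longrightarrow> gamma_lift f (tree_gamma t) = f t"
  unfolding gamma_lift_def
  by (simp add: zero_tword.rep_eq flip: basis_zero)
    (rule lin_mult, simp add: plus_tword.rep_eq, simp add: tree_gamma_def letters_word)

lemma tree_gamma_Leaf: "tree_gamma Leaf = 1"
  by (simp add: tree_gamma_def word_Leaf basis_zero)

lemma decompositions_Graft:
  "{(t1, t2). Graft t s = over t1 t2}
     = insert (Graft t s, Leaf) ((\<lambda>(t1, t2). (t1, Graft t2 s)) ` {(t1, t2). t = over t1 t2})"
  (is "?L = ?R")
proof
  show "?L \<subseteq> ?R"
  proof
    fix p assume "p \<in> ?L"
    then show "p \<in> ?R"
      by (cases p; cases "snd p") (auto simp: image_iff)
  qed
qed auto

lemma decompositions_Leaf: "{(t1, t2). Leaf = over t1 t2} = {(Leaf, Leaf)}"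
  (is "?L = _")
proof
  show "?L \<subseteq> {(Leaf, Leaf)}"
  proof
    fix p assume "p \<in> ?L"
    then show "p \<in> {(Leaf, Leaf)}"
      by (cases p; cases "snd p") auto
  qed
qed auto

lemma finite_decompositions: "finite {(t1, t2). t = over t1 t2}"
  by (induction t) (auto simp: decompositions_Leaf decompositions_Graft)

lemma Delta_p_tree_Leaf: "Delta_p_tree Leaf = 1"
  by (simp add: Delta_p_tree_def decompositions_Leaf tree_gamma_def word_Leaf basis_zero
      flip: zero_prod_def)

lemma Delta_p_tree_Graft:
  "Delta_p_tree (Graft t s) = tensor (tree_gamma (Graft t s)) 1
     + (\<Sum>(t1, t2)\<in>{(t1, t2). t = over t1 t2}. tensor (tree_gamma t1) (tree_gamma (Graft t2 s)))"
proof -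
  let ?D = "{(t1, t2). t = over t1 t2}" and ?g = "\<lambda>(t1, t2). (t1, Graft t2 s)"
  let ?T = "\<lambda>(t1, t2). tensor (tree_gamma t1) (tree_gamma t2)"
  have "inj_on ?g ?D"
    by (auto simp: inj_on_def)
  then have reindex: "sum ?T (?g ` ?D) = sum (?T \<circ> ?g) ?D"
    by (rule sum.reindex)
  have notin: "(Graft t s, Leaf) \<notin> ?g ` ?D"
    by auto
  have fin: "finite (?g ` ?D)"
    by (rule finite_imageI) (rule finite_decompositions)
  have "Delta_p_tree (Graft t s) = ?T (Graft t s, Leaf) + sum (?T \<circ> ?g) ?D"
    unfolding Delta_p_tree_def decompositions_Graft sum.insert[OF fin notin] reindex ..
  then show ?thesis
    by (simp add: tree_gamma_Leaf o_def case_prod_unfold)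
qed

lemma delta_gamma_tree_Leaf: "delta_gamma_tree Leaf = 1"
  by (simp add: delta_gamma_tree_def delta_tilde_def tensor_map_basis incl_gamma_def pi_ab_morphism
      tree_gamma_Leaf tensor_one)

lemma delta_gamma_tree_gamma: "delta_gamma (tree_gamma t) = delta_gamma_tree t"
  by (simp add: delta_gamma_def gamma_lift_morphism delta_gamma_tree_Leaf)

lemma Delta_p_gamma_tree_gamma: "Delta_p_gamma (tree_gamma t) = Delta_p_tree t"
  by (simp add: Delta_p_gamma_def gamma_lift_morphism Delta_p_tree_Leaf)

lemma sigma_word: "sigma (basis (word u)) = pi_ab (basis (foldr over u Leaf))"
proof -
  have "foldr over u Leaf = sum_list u" for u
    by (induction u) (auto simp: plus_ptree_def zero_ptree_def)
  moreover have "prod_list (map (\<lambda>t. pi_ab (basis t)) (filter (\<lambda>t. t \<noteq> Leaf) u))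
      = pi_ab (basis (sum_list u))"
    by (induction u) (auto simp: pi_ab_morphism zero_ptree_def simp flip: basis_mult)
  ultimately show ?thesis
    by (simp add: sigma_def gamma_lift_def letters_word)
qed

end

theory Submission
  imports Defs
begin

text \<open>
  The content of the theorem already lies in the span of the trees. Write \<open>\<Delta>\<^sub>Y = (Id \<otimes> \<pi>) \<Delta>~\<close> and
  \<open>\<delta> = (Id \<otimes> \<pi>) \<delta>~\<close>. On a tree \<open>t = V(s\<^sub>1) / \<dots> / V(s\<^sub>n)\<close> the map \<open>\<Delta>\<^sub>Y\<close> is the product of the factors
  \<open>1 \<otimes> V(s\<^sub>i) + \<delta>(V(s\<^sub>i))\<close>. Expand it and group the terms by the last factor in which \<open>\<delta>\<close> is chosen:
  the part up to this factor is \<open>\<delta>(t\<^sub>1)\<close>, by \<open>\<delta>(t \<or> s) = \<Delta>\<^sub>Y(t) / \<delta>(V(s))\<close>, and the rest is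
  \<open>1 \<otimes> \<pi>(t\<^sub>2)\<close>, where \<open>t = t\<^sub>1 / t\<^sub>2\<close>. The sum of these products over all decompositions is \<open>\<Delta>\<^sup>\<gamma>(t)\<close>,
  so \<open>\<Delta>\<^sup>\<gamma>\<close> is \<open>\<Delta>\<^sub>Y\<close> on single trees (\<open>Delta_Y_eq_sum\<close>, \<open>Delta_gamma_tree_gamma\<close>).

  So on trees one has to show that \<open>\<Delta>\<^sub>Y\<close> is coassociative. Unlike \<open>\<delta>\<close>, the map \<open>\<Delta>\<^sub>Y\<close> is multiplicative
  for the over product, which leaves the trees \<open>V(t)\<close>. Since \<open>\<Delta>\<^sub>Y(V(t)) = 1 \<otimes> V(t) + (V \<otimes> Id) \<delta>(t)\<close> and
  \<open>\<Delta>\<^sup>\<alpha> \<pi> = (\<pi> \<otimes> Id) \<Delta>\<^sub>Y\<close> (\<open>Delta_alpha_pi_ab\<close>), the terms with first factor \<open>1\<close> agree on both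
  sides, and what remains is \<open>V\<close> applied to the coassociativity of \<open>\<delta>\<close> at the smaller tree \<open>t\<close>
  (\<open>coassociative_V\<close>). The coassociativity of \<open>\<delta>\<close> at \<open>t \<or> s\<close> in turn follows from that of \<open>\<Delta>\<^sub>Y\<close> at \<open>t\<close>
  and that of \<open>\<delta>\<close> at \<open>s\<close>, so the two statements are proved by a joint induction on trees
  (\<open>coassociative_trees\<close>).
  
  Finally \<open>\<Delta>\<^sup>\<gamma>\<close> is a composite of algebra morphisms; commutativity of \<open>H\<^sup>\<alpha>\<close> makes its
  multiplication map one of them. Hence both sides of the coassociativity equation are algebra
  morphisms on \<open>H\<^sup>\<gamma>\<close>, and it suffices that they agree on single trees.
\<close>

section \<open>Linear maps and tensor products\<close>

definition linear_map :: "('a vec \<Rightarrow> 'b vec) \<Rightarrow> bool"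
  where "linear_map f \<longleftrightarrow> (\<forall>x y. f (x + y) = f x + f y) \<and> (\<forall>c x. f (smul c x) = smul c (f x))"

lemma linear_map_add: "linear_map f \<Longrightarrow> f (x + y) = f x + f y"
  and linear_map_smul: "linear_map f \<Longrightarrow> f (smul c x) = smul c (f x)"
  by (simp_all add: linear_map_def)

lemma smul_zero: "smul 0 x = 0"
  and smul_add: "smul c (x + y) = smul c x + smul c y"
  by (rule poly_mapping_eqI; simp add: lookup_add algebra_simps)+

lemma linear_map_zero: "linear_map f \<Longrightarrow> f 0 = 0"
  using linear_map_smul[of f 0 0] by (simp add: smul_zero)

lemma linear_map_sum: "linear_map f \<Longrightarrow> f (\<Sum>a\<in>A. g a) = (\<Sum>a\<in>A. f (g a))"
  by (induction A rule: infinite_finite_induct) (simp_all add: linear_map_zero linear_map_add)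

lemma linear_map_eq_lin:
  assumes "linear_map f"
  shows "f x = lin (\<lambda>b. f (basis b)) x"
proof -
  have "f x = (\<Sum>a\<in>Poly_Mapping.keys x. f (smul (Poly_Mapping.lookup x a) (basis a)))"
    by (subst vec_expand) (rule linear_map_sum[OF assms])
  then show ?thesis
    by (simp add: lin_def linear_map_smul[OF assms])
qed

lemma linear_map_eqI:
  assumes "linear_map f" "linear_map g" "\<And>b. f (basis b) = g (basis b)"
  shows "f x = g x"
  using linear_map_eq_lin[OF assms(1), of x] linear_map_eq_lin[OF assms(2), of x] assms(3) by simp

lemma linear_map_lin: "linear_map (lin f)"
  by (simp add: linear_map_def lin_add lin_smul)

lemma linear_map_id: "linear_map id" "linear_map (\<lambda>x. x)"
  by (simp_all add: linear_map_def)

lemma linear_map_compose: "linear_map f \<Longrightarrow> linear_map g \<Longrightarrow> linear_map (\<lambda>x. f (g x))"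
  by (simp add: linear_map_def)

lemma linear_map_plus: "linear_map f \<Longrightarrow> linear_map g \<Longrightarrow> linear_map (\<lambda>x. f x + g x)"
  by (simp add: linear_map_def smul_add)

lemma linear_map_times:
  fixes f :: "'a vec \<Rightarrow> 'b::monoid_add vec"
  assumes "linear_map f"
  shows "linear_map (\<lambda>x. f x * y)" "linear_map (\<lambda>x. y * f x)"
proof -
  have "smul 1 z = z" for z :: "'b vec"
    by (rule poly_mapping_eqI) simp
  then have "smul c z * y = smul c (z * y)" "y * smul c z = smul c (y * z)" for c z
    using smul_mult_smul[of c z 1 y] smul_mult_smul[of 1 y c z] by simp_all
  then show "linear_map (\<lambda>x. f x * y)" "linear_map (\<lambda>x. y * f x)"
    using assms by (simp_all add: linear_map_def algebra_simps)
qed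

lemma lin_plus_fun: "lin (\<lambda>a. f a + g a) x = lin f x + lin g x"
  and lin_smul_fun: "lin (\<lambda>a. smul c (f a)) x = smul c (lin f x)"
  by (rule poly_mapping_eqI;
      simp add: lin_def lookup_sum_vec lookup_add sum.distrib sum_distrib_left algebra_simps)+

lemma linear_map_tensor: "linear_map (\<lambda>u. tensor u v)" "linear_map (\<lambda>v. tensor u v)"
  by (simp_all add: linear_map_def tensor_def lin_add lin_smul lin_plus_fun lin_smul_fun)

lemma linear_map_tensor_map: "linear_map (tensor_map f g)"
  and linear_map_tensor_assoc: "linear_map tensor_assoc"
  and linear_map_V: "linear_map V"
  by (simp_all add: tensor_map_def tensor_assoc_def V_def linear_map_lin)

text \<open>
  Each rule absorbs one map applied on the outside, so that a composite is recognised as linear by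
  peeling off its maps one at a time down to the identity.
\<close>

lemmas linear_map_intros =
  linear_map_id linear_map_plus linear_map_times
  linear_map_lin[THEN linear_map_compose]
  linear_map_V[THEN linear_map_compose]
  linear_map_tensor[THEN linear_map_compose]
  linear_map_tensor_map[THEN linear_map_compose]
  linear_map_tensor_assoc[THEN linear_map_compose]

lemma bilinear_eqI:
  assumes "\<And>y. linear_map (\<lambda>x. f x y)" "\<And>x. linear_map (f x)"
    and "\<And>y. linear_map (\<lambda>x. g x y)" "\<And>x. linear_map (g x)"
    and "\<And>a b. f (basis a) (basis b) = g (basis a) (basis b)"
  shows "f x y = g x y"
proof -
  have "f (basis a) y = g (basis a) y" for a
    by (rule linear_map_eqI[OF assms(2,4)]) (rule assms(5))
  then show ?thesis
    by (rule linear_map_eqI[OF assms(1,3)])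
qed

lemma tensor_map_tensor:
  assumes "linear_map f" "linear_map g"
  shows "tensor_map f g (tensor u v) = tensor (f u) (g v)"
  by (rule bilinear_eqI[where f = "\<lambda>u v. tensor_map f g (tensor u v)"])
    (intro linear_map_intros assms[THEN linear_map_compose] | simp add: tensor_map_basis)+

lemma tensor_map_id_id: "tensor_map id id = id"
proof
  fix x :: "('a \<times> 'b) vec"
  show "tensor_map id id x = id x"
    by (rule linear_map_eqI) (auto simp: linear_map_tensor_map linear_map_id tensor_map_basis)
qed

lemma tensor_map_tensor_map:
  assumes "linear_map f" "linear_map g"
  shows "tensor_map f g (tensor_map h k x) = tensor_map (\<lambda>x. f (h x)) (\<lambda>x. g (k x)) x"
proof (rule linear_map_eqI[where f = "\<lambda>x. tensor_map f g (tensor_map h k x)"])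
  fix b
  show "tensor_map f g (tensor_map h k (basis b)) = tensor_map (\<lambda>x. f (h x)) (\<lambda>x. g (k x)) (basis b)"
    by (cases b) (simp add: tensor_map_basis tensor_map_tensor[OF assms])
qed (intro linear_map_intros)+

lemma tensor_assoc_tensor: "tensor_assoc (tensor (tensor u v) w) = tensor u (tensor v w)"
proof (rule bilinear_eqI[where f = "\<lambda>u v. tensor_assoc (tensor (tensor u v) w)"])
  fix a b
  show "tensor_assoc (tensor (tensor (basis a) (basis b)) w) = tensor (basis a) (tensor (basis b) w)"
    by (rule linear_map_eqI[where x = w]) (intro linear_map_intros | simp add: tensor_assoc_def)+
qed (intro linear_map_intros)+

lemma tensor_mult: "tensor u v * tensor u' v' = tensor (u * u') (v * v')"
proof -
  have 1: "tensor (basis a) (basis b) * tensor u' v' = tensor (basis a * u') (basis b * v')" for a b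
    by (rule bilinear_eqI[where x = u' and y = v'])
      (intro linear_map_intros | simp add: basis_mult)+
  show ?thesis
    by (rule bilinear_eqI[where x = u and y = v])
      (intro linear_map_intros 1)+
qed

lemma tensor_assoc_tensor_map:
  assumes "linear_map f" "linear_map g" "linear_map h"
  shows "tensor_assoc (tensor_map (tensor_map f g) h x) = tensor_map f (tensor_map g h) (tensor_assoc x)"
proof (rule linear_map_eqI[where x = x])
  fix p :: "('a \<times> 'c) \<times> 'e"
  obtain a b c where "p = ((a, b), c)"
    by (metis surj_pair)
  then show "tensor_assoc (tensor_map (tensor_map f g) h (basis p))
      = tensor_map f (tensor_map g h) (tensor_assoc (basis p))"
    by (simp add: tensor_map_basis tensor_assoc_tensor)
      (simp add: tensor_map_basis tensor_assoc_def)
qed (intro linear_map_intros)+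

section \<open>Algebra morphisms of monoid algebras\<close>

definition alg_morphism :: "('a::monoid_add vec \<Rightarrow> 'b::monoid_add vec) \<Rightarrow> bool"
  where "alg_morphism f \<longleftrightarrow> linear_map f \<and> f 1 = 1 \<and> (\<forall>x y. f (x * y) = f x * f y)"

lemma alg_morphism_linear: "alg_morphism f \<Longrightarrow> linear_map f"
  and alg_morphism_one: "alg_morphism f \<Longrightarrow> f 1 = 1"
  and alg_morphism_mult: "alg_morphism f \<Longrightarrow> f (x * y) = f x * f y"
  by (simp_all add: alg_morphism_def)

lemma alg_morphism_lin:
  assumes "f 0 = 1" "\<And>a b. f (a + b) = f a * f b"
  shows "alg_morphism (lin f)"
  using assms by (simp add: alg_morphism_def linear_map_lin lin_mult flip: basis_zero)

lemma alg_morphism_id: "alg_morphism id" "alg_morphism (\<lambda>x. x)"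
  by (simp_all add: alg_morphism_def linear_map_id)

lemma alg_morphism_compose: "alg_morphism f \<Longrightarrow> alg_morphism g \<Longrightarrow> alg_morphism (\<lambda>x. f (g x))"
  by (simp add: alg_morphism_def linear_map_compose)

lemma alg_morphism_tensor_map:
  assumes "alg_morphism f" "alg_morphism g"
  shows "alg_morphism (tensor_map f g)"
  unfolding tensor_map_def
proof (rule alg_morphism_lin)
  show "(case 0 of (a, b) \<Rightarrow> tensor (f (basis a)) (g (basis b))) = 1"
    using assms by (simp add: zero_prod_def basis_zero alg_morphism_one tensor_one)
next
  fix p q :: "'a \<times> 'c"
  show "(case p + q of (a, b) \<Rightarrow> tensor (f (basis a)) (g (basis b)))
      = (case p of (a, b) \<Rightarrow> tensor (f (basis a)) (g (basis b)))
        * (case q of (a, b) \<Rightarrow> tensor (f (basis a)) (g (basis b)))"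
    using assms by (cases p; cases q) (simp add: alg_morphism_mult tensor_mult flip: basis_mult)
qed

lemma alg_morphism_tensor_assoc: "alg_morphism tensor_assoc"
  unfolding tensor_assoc_def
  by (rule alg_morphism_lin) (auto simp: basis_mult zero_prod_def simp flip: basis_zero)

text \<open>
  Here commutativity is essential: multiplication is an algebra morphism on the tensor square of an
  algebra only if \<open>a b a' b' = a a' b b'\<close>.
\<close>

lemma alg_morphism_mult_map: "alg_morphism (mult_map :: ('a::comm_monoid_add \<times> 'a) vec \<Rightarrow> _)"
  unfolding mult_map_def
  by (rule alg_morphism_lin) (auto simp: basis_mult basis_zero zero_prod_def algebra_simps)

section \<open>The structure maps as algebra morphisms\<close>

lemma alg_morphism_pi_ab: "alg_morphism pi_ab"
  unfolding pi_ab_def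
  by (rule alg_morphism_lin) (simp_all add: pi_tree_over basis_mult zero_ptree_def basis_zero
      flip: zero_multiset_def)

lemma alg_morphism_Delta_tilde: "alg_morphism Delta_tilde"
  unfolding Delta_tilde_def
proof (rule alg_morphism_lin)
  show "Dtil_tree 0 = 1"
    by (simp add: zero_ptree_def basis_Leaf_Leaf)
  show "Dtil_tree (t + s) = Dtil_tree t * Dtil_tree s" for t s
    unfolding plus_ptree_def
    by (induction s) (simp_all add: basis_Leaf_Leaf mult.assoc)
qed

lemma alg_morphism_alpha_lift: "alg_morphism (alpha_lift f)"
  unfolding alpha_lift_def by (rule alg_morphism_lin) simp_all

lemma alg_morphism_gamma_lift: "alg_morphism (gamma_lift f)"
  unfolding gamma_lift_def
  by (rule alg_morphism_lin) (simp_all add: zero_tword.rep_eq plus_tword.rep_eq)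

lemma alg_morphism_Delta_alpha: "alg_morphism Delta_alpha"
  unfolding Delta_alpha_def by (rule alg_morphism_alpha_lift)

lemmas alg_morphism_intros =
  alg_morphism_id
  alg_morphism_tensor_map alg_morphism_tensor_map[THEN alg_morphism_compose]
  alg_morphism_tensor_assoc[THEN alg_morphism_compose]
  alg_morphism_mult_map[THEN alg_morphism_compose]
  alg_morphism_gamma_lift[THEN alg_morphism_compose]
  alg_morphism_pi_ab[THEN alg_morphism_compose]
  alg_morphism_Delta_tilde[THEN alg_morphism_compose]
  alg_morphism_Delta_alpha[THEN alg_morphism_compose]

lemma alg_morphism_Delta_gamma: "alg_morphism Delta_gamma"
  unfolding Delta_gamma_def comp_def m_alpha_def delta_gamma_def sigma_def Delta_p_gamma_def
  by (intro alg_morphism_intros)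

text \<open>
  Through this form of grafting, multiplicativity of a map reduces statements about all trees
  to statements about the trees with a bare left branch.
\<close>

lemma basis_Graft: "basis (Graft t s) = basis t * V (basis s)"
  by (simp add: V_def basis_mult flip: Graft_eq_over)

lemma alg_morphism_eqI_trees:
  assumes "alg_morphism f" "alg_morphism g" "\<And>t. f (V (basis t)) = g (V (basis t))"
  shows "f x = g x"
proof (rule linear_map_eqI[OF assms(1,2)[THEN alg_morphism_linear]])
  fix t
  show "f (basis t) = g (basis t)"
  proof (induction t)
    case Leaf
    show ?case
      using assms(1,2)[THEN alg_morphism_one] by (simp add: basis_zero flip: zero_ptree_def)
  next
    case (Graft t s)
    then show ?case
      using assms(3)[of s] assms(1,2)[THEN alg_morphism_mult] by (simp add: basis_Graft)
  qed
qed

lemma alg_morphism_eqI_gamma: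
  assumes "alg_morphism f" "alg_morphism g" "\<And>t. f (tree_gamma t) = g (tree_gamma t)"
  shows "f x = g x"
proof (rule linear_map_eqI[OF assms(1,2)[THEN alg_morphism_linear]])
  fix w
  have "f (basis (word u)) = g (basis (word u))" for u
  proof (induction u)
    case Nil
    then show ?case
      using assms(1,2)[THEN alg_morphism_one] by (simp add: word_Nil basis_zero)
  next
    case (Cons t u)
    have "basis (word (t # u)) = tree_gamma t * basis (word u)"
      using word_append[of "[t]" u] by (simp add: tree_gamma_def basis_mult)
    then show ?case
      using Cons assms(3) assms(1,2)[THEN alg_morphism_mult] by simp
  qed
  then show "f (basis w) = g (basis w)"
    by (metis word_letters)
qed

section \<open>The coaction on trees\<close>

text \<open>
  The maps \<open>\<Delta>~\<close> and \<open>\<delta>~\<close> with abelianized right factor. Only the right factor is abelianized,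
  because the left one has to be fed to the same map again.
\<close>

definition Delta_Y :: "ptree vec \<Rightarrow> (ptree \<times> ptree multiset) vec"
  where "Delta_Y x = tensor_map id pi_ab (Delta_tilde x)"

definition delta_Y :: "ptree vec \<Rightarrow> (ptree \<times> ptree multiset) vec"
  where "delta_Y x = tensor_map id pi_ab (delta_tilde x)"

lemma alg_morphism_Delta_Y: "alg_morphism Delta_Y"
  unfolding Delta_Y_def
  by (intro alg_morphism_intros)

lemma linear_map_Delta_Y: "linear_map Delta_Y"
  and linear_map_Delta_alpha: "linear_map Delta_alpha"
  by (rule alg_morphism_linear alg_morphism_Delta_Y alg_morphism_Delta_alpha)+

lemma linear_map_delta_Y: "linear_map delta_Y"
  unfolding delta_Y_def delta_tilde_def by (intro linear_map_intros)

lemma linear_map_pi_ab: "linear_map pi_ab"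
  by (rule alg_morphism_linear[OF alg_morphism_pi_ab])

lemma basis_Leaf: "basis Leaf = 1"
  by (simp add: basis_zero flip: zero_ptree_def)

lemma delta_Y_one: "delta_Y 1 = 1"
  using Delta_delta_tilde_rec(2)
  by (simp add: delta_Y_def basis_Leaf tensor_one del: tensor_basis)
    (rule alg_morphism_one[OF alg_morphism_tensor_map[OF alg_morphism_id(1) alg_morphism_pi_ab]])

lemma delta_Y_V: "delta_Y (V x) = tensor_map V id (delta_Y x)"
proof (rule linear_map_eqI[where x = x])
  fix t
  show "delta_Y (V (basis t)) = tensor_map V id (delta_Y (basis t))"
    by (simp add: delta_Y_def Delta_delta_tilde_rec tensor_map_tensor_map linear_map_V
      linear_map_id linear_map_pi_ab)
qed (intro linear_map_intros linear_map_delta_Y[THEN linear_map_compose])+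

lemma Delta_Y_V: "Delta_Y (V x) = tensor 1 (pi_ab (V x)) + delta_Y (V x)"
proof (rule linear_map_eqI[where x = x])
  fix t
  show "Delta_Y (V (basis t)) = tensor 1 (pi_ab (V (basis t))) + delta_Y (V (basis t))"
    unfolding Delta_Y_def delta_Y_def Delta_delta_tilde_rec(4)
    by (simp add: linear_map_add[OF linear_map_tensor_map] tensor_map_tensor linear_map_id
        linear_map_pi_ab basis_zero flip: zero_ptree_def)
qed (intro linear_map_intros linear_map_delta_Y[THEN linear_map_compose]
    linear_map_pi_ab[THEN linear_map_compose] linear_map_Delta_Y[THEN linear_map_compose])+

text \<open>
  This replaces multiplicativity, which \<open>\<delta>\<close> does not have: all factors but the last one are treated
  by \<open>\<Delta>\<^sub>Y\<close>.
\<close>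

lemma delta_Y_over_V: "delta_Y (x * V y) = Delta_Y x * delta_Y (V y)"
proof (rule bilinear_eqI[where x = x and y = y])
  fix t s
  show "delta_Y (basis t * V (basis s)) = Delta_Y (basis t) * delta_Y (V (basis s))"
    by (simp add: delta_Y_def Delta_Y_def Delta_delta_tilde_rec(6) flip: basis_Graft)
      (simp add: alg_morphism_mult alg_morphism_tensor_map alg_morphism_id alg_morphism_pi_ab)
qed (intro linear_map_intros linear_map_delta_Y[THEN linear_map_compose]
    linear_map_Delta_Y[THEN linear_map_compose])+

text \<open>
  Both sides are algebra morphisms, and on \<open>V(t)\<close> this is how \<open>\<Delta>\<^sup>\<alpha>\<close> is defined. It is what turns the
  second application of the coproduct, on the right factor, into an application of \<open>\<Delta>\<^sub>Y\<close>.
\<close>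

lemma Delta_alpha_pi_ab: "Delta_alpha (pi_ab x) = tensor_map pi_ab id (Delta_Y x)"
proof (rule alg_morphism_eqI_trees[where x = x])
  fix t
  show "Delta_alpha (pi_ab (V (basis t))) = tensor_map pi_ab id (Delta_Y (V (basis t)))"
    by (simp add: pi_ab_morphism Delta_alpha_def alpha_lift_morphism Delta_Y_def
        tensor_map_tensor_map linear_map_id linear_map_pi_ab)
qed (intro alg_morphism_intros alg_morphism_Delta_Y[THEN alg_morphism_compose])+

lemma delta_Y_V_iterated:
  "tensor_assoc (tensor_map delta_Y id (tensor_map V id z))
    = tensor_map V id (tensor_assoc (tensor_map delta_Y id z))"
proof -
  have "tensor_map delta_Y id (tensor_map V id z) = tensor_map (tensor_map V id) id (tensor_map delta_Y id z)"
    by (simp add: tensor_map_tensor_map linear_map_delta_Y linear_map_tensor_map linear_map_id delta_Y_V)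
  then show ?thesis
    by (simp only: tensor_assoc_tensor_map linear_map_V linear_map_id tensor_map_id_id)
qed

text \<open>
  Applying \<open>\<Delta>\<^sub>Y\<close> to a left factor in the image of \<open>V\<close> gives, besides the term
  given by \<open>\<delta>\<close>, the one that puts \<open>1\<close> in the first place and moves this factor to the second.
\<close>

lemma Delta_Y_V_iterated:
  fixes z :: "(ptree \<times> 'c) vec"
  shows "tensor_assoc (tensor_map Delta_Y id (tensor_map V id z))
    = tensor 1 (tensor_map (\<lambda>x. pi_ab (V x)) id z)
      + tensor_assoc (tensor_map delta_Y id (tensor_map V id z))"
proof (rule linear_map_eqI[where x = z])
  fix p :: "ptree \<times> 'c"
  obtain t m where p: "p = (t, m)"
    by (cases p)
  show "tensor_assoc (tensor_map Delta_Y id (tensor_map V id (basis p)))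
      = tensor 1 (tensor_map (\<lambda>x. pi_ab (V x)) id (basis p))
        + tensor_assoc (tensor_map delta_Y id (tensor_map V id (basis p)))"
    unfolding p tensor_map_basis
    by (simp add: tensor_map_tensor linear_map_Delta_Y linear_map_delta_Y linear_map_id Delta_Y_V
        linear_map_add[OF linear_map_tensor(1)] linear_map_add[OF linear_map_tensor_assoc]
        tensor_assoc_tensor)
qed (intro linear_map_intros)+

lemma delta_Y_over_V_iterated:
  fixes z z' :: "(ptree \<times> 'c::monoid_add) vec"
  shows "tensor_map delta_Y id (z * tensor_map V id z')
    = tensor_map Delta_Y id z * tensor_map delta_Y id (tensor_map V id z')"
proof (rule bilinear_eqI[where x = z and y = z'])
  fix p q :: "ptree \<times> 'c"
  show "tensor_map delta_Y id (basis p * tensor_map V id (basis q))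
      = tensor_map Delta_Y id (basis p) * tensor_map delta_Y id (tensor_map V id (basis q))"
    by (cases p; cases q)
      (simp add: tensor_map_basis tensor_map_tensor linear_map_delta_Y linear_map_Delta_Y
        linear_map_V linear_map_id tensor_mult delta_Y_over_V flip: tensor_basis)
qed (intro linear_map_intros)+

text \<open>
  For \<open>\<delta>\<close> both sides are the images under \<open>V\<close>, acting on the first factor, of the two sides of the
  assumption. For \<open>\<Delta>\<^sub>Y\<close> the additional terms have first factor \<open>1\<close>; on both sides they add up to
  \<open>1 \<otimes> \<Delta>\<^sup>\<alpha>(V(x))\<close>.
\<close>

lemma coassociative_V:
  assumes "tensor_assoc (tensor_map delta_Y id (delta_Y x)) = tensor_map id Delta_alpha (delta_Y x)"
  shows "tensor_assoc (tensor_map delta_Y id (delta_Y (V x))) = tensor_map id Delta_alpha (delta_Y (V x))"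
    and "tensor_assoc (tensor_map Delta_Y id (Delta_Y (V x))) = tensor_map id Delta_alpha (Delta_Y (V x))"
proof -
  have "tensor_map id Delta_alpha (tensor_map V id (delta_Y x))
      = tensor_map V id (tensor_map id Delta_alpha (delta_Y x))"
    by (simp add: tensor_map_tensor_map linear_map_V linear_map_Delta_alpha linear_map_id)
  then show delta: "tensor_assoc (tensor_map delta_Y id (delta_Y (V x)))
      = tensor_map id Delta_alpha (delta_Y (V x))"
    by (simp only: delta_Y_V delta_Y_V_iterated assms)
  let ?p = "pi_ab (V x)"
  have "tensor_assoc (tensor_map Delta_Y id (tensor 1 ?p)) = tensor 1 (tensor 1 ?p)"
    by (simp add: tensor_map_tensor linear_map_Delta_Y linear_map_id tensor_assoc_tensor
        alg_morphism_one[OF alg_morphism_Delta_Y] flip: tensor_one[where 'a = ptree])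
  then have "tensor_assoc (tensor_map Delta_Y id (Delta_Y (V x)))
      = tensor 1 (tensor 1 ?p) + tensor 1 (tensor_map (\<lambda>x. pi_ab (V x)) id (delta_Y x))
        + tensor_assoc (tensor_map delta_Y id (delta_Y (V x)))"
    by (simp only: Delta_Y_V linear_map_add[OF linear_map_tensor_map]
        linear_map_add[OF linear_map_tensor_assoc] delta_Y_V Delta_Y_V_iterated add.assoc)
  also have "tensor_map (\<lambda>x. pi_ab (V x)) id (delta_Y x) = tensor_map pi_ab id (delta_Y (V x))"
    by (simp add: delta_Y_V tensor_map_tensor_map linear_map_pi_ab linear_map_id flip: id_def)
  also have "tensor 1 (tensor 1 ?p) + tensor 1 (tensor_map pi_ab id (delta_Y (V x)))
      = tensor 1 (Delta_alpha ?p)"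
    by (simp add: Delta_alpha_pi_ab Delta_Y_V linear_map_add[OF linear_map_tensor_map]
        linear_map_add[OF linear_map_tensor(2)] tensor_map_tensor linear_map_pi_ab linear_map_id
        alg_morphism_one[OF alg_morphism_pi_ab])
  also have "tensor 1 (Delta_alpha ?p) = tensor_map id Delta_alpha (tensor 1 ?p)"
    by (simp add: tensor_map_tensor linear_map_Delta_alpha linear_map_id)
  finally show "tensor_assoc (tensor_map Delta_Y id (Delta_Y (V x)))
      = tensor_map id Delta_alpha (Delta_Y (V x))"
    by (simp only: delta Delta_Y_V linear_map_add[OF linear_map_tensor_map])
qed

text \<open>
  The induction has to treat both maps at once: the step for either map at \<open>t \<or> s\<close> uses the hypothesis
  for \<open>\<Delta>\<^sub>Y\<close> at \<open>t\<close> and the hypothesis for \<open>\<delta>\<close> at \<open>s\<close>.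
\<close>

lemma coassociative_trees:
  "tensor_assoc (tensor_map delta_Y id (delta_Y (basis t))) = tensor_map id Delta_alpha (delta_Y (basis t))"
  "tensor_assoc (tensor_map Delta_Y id (Delta_Y (basis t))) = tensor_map id Delta_alpha (Delta_Y (basis t))"
proof (induction t)
  case Leaf
  have "tensor_map delta_Y id 1 = 1"
    using tensor_map_tensor[OF linear_map_delta_Y linear_map_id(1), of 1 1]
    by (simp add: tensor_one delta_Y_one)
  {
    case 1
    then show ?case
      by (simp only: \<open>tensor_map delta_Y id 1 = 1\<close> basis_Leaf delta_Y_one alg_morphism_one
          alg_morphism_tensor_map alg_morphism_tensor_assoc alg_morphism_id alg_morphism_Delta_alpha)
  next
    case 2
    show ?case
      by (simp add: basis_Leaf alg_morphism_one alg_morphism_tensor_map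
          alg_morphism_tensor_assoc alg_morphism_id alg_morphism_Delta_Y alg_morphism_Delta_alpha)
  }
next
  case (Graft t s)
  note multiplicative = alg_morphism_mult alg_morphism_tensor_map alg_morphism_tensor_assoc
    alg_morphism_id alg_morphism_Delta_Y alg_morphism_Delta_alpha
  {
    case 1
    have "tensor_assoc (tensor_map delta_Y id (delta_Y (basis (Graft t s))))
        = tensor_assoc (tensor_map Delta_Y id (Delta_Y (basis t)))
          * tensor_assoc (tensor_map delta_Y id (delta_Y (V (basis s))))"
      by (simp only: basis_Graft delta_Y_over_V delta_Y_V delta_Y_over_V_iterated multiplicative)
    also have "\<dots> = tensor_map id Delta_alpha (delta_Y (basis (Graft t s)))"
      by (simp only: Graft.IH(2) coassociative_V(1)[OF Graft.IH(3)] basis_Graft delta_Y_over_V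
          multiplicative)
    finally show ?case .
  next
    case 2
    show ?case
      by (simp only: basis_Graft multiplicative Graft.IH(2) coassociative_V(2)[OF Graft.IH(3)])
  }
qed

section \<open>From trees to words\<close>

text \<open>
  The decompositions of \<open>t \<or> s\<close> are the trivial one, with second part \<open>|\<close>, and those obtained from
  the decompositions of \<open>t\<close> by grafting \<open>s\<close> onto the second part. The former gives
  \<open>\<Delta>\<^sub>Y(t) / \<delta>(V(s))\<close>; the latter give \<open>\<Delta>\<^sub>Y(t) \<cdot> (1 \<otimes> V(s))\<close> by induction.
\<close>

lemma Delta_Y_eq_sum:
  "Delta_Y (basis t)
    = (\<Sum>(t1, t2)\<in>{(t1, t2). t = over t1 t2}. delta_Y (basis t1) * tensor 1 (pi_ab (basis t2)))"
proof (induction t)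
  case Leaf
  show ?case
    by (simp add: decompositions_Leaf basis_Leaf delta_Y_one alg_morphism_one[OF alg_morphism_Delta_Y]
        alg_morphism_one[OF alg_morphism_pi_ab] tensor_one)
next
  case (Graft t s)
  let ?D = "{(t1, t2). t = over t1 t2}" and ?g = "\<lambda>(t1, t2). (t1, Graft t2 s)"
  let ?T = "\<lambda>(t1, t2). delta_Y (basis t1) * tensor 1 (pi_ab (basis t2))"
  have step: "?T (?g p) = ?T p * tensor 1 (pi_ab (V (basis s)))" for p
    by (cases p)
      (simp add: basis_Graft alg_morphism_mult[OF alg_morphism_pi_ab] tensor_mult mult.assoc)
  have "inj_on ?g ?D" "finite (?g ` ?D)" "(Graft t s, Leaf) \<notin> ?g ` ?D"
    by (auto simp: inj_on_def finite_decompositions)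
  then have "sum ?T {(t1, t2). Graft t s = over t1 t2} = ?T (Graft t s, Leaf) + (\<Sum>p\<in>?D. ?T (?g p))"
    unfolding decompositions_Graft by (simp add: sum.reindex comp_def)
  also have "(\<Sum>p\<in>?D. ?T (?g p)) = Delta_Y (basis t) * tensor 1 (pi_ab (V (basis s)))"
    unfolding step Graft.IH(1) by (rule sum_distrib_right[symmetric])
  also have "?T (Graft t s, Leaf) = Delta_Y (basis t) * delta_Y (V (basis s))"
    by (simp add: basis_Graft delta_Y_over_V basis_Leaf alg_morphism_one[OF alg_morphism_pi_ab] tensor_one)
  finally show ?case
    by (simp add: basis_Graft alg_morphism_mult[OF alg_morphism_Delta_Y] Delta_Y_V distrib_left add.commute)
qed

lemma mult_map_tensor_assoc:
  fixes z :: "('a::monoid_add \<times> 'b::monoid_add) vec"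
  shows "tensor_map id mult_map (tensor_assoc (tensor z y)) = z * tensor 1 y"
proof (rule bilinear_eqI[where x = z and y = y])
  fix p :: "'a \<times> 'b" and c :: 'b
  obtain a b where "p = (a, b)" by (cases p)
  then show "tensor_map id mult_map (tensor_assoc (tensor (basis p) (basis c))) = basis p * tensor 1 (basis c)"
    by (simp add: tensor_assoc_def tensor_map_basis mult_map_def basis_mult flip: basis_zero)
qed (intro linear_map_intros)+

text \<open>
  The map \<open>f\<close> is only linear here, as it will be the inclusion of the span of trees into the free
  algebra on trees: it does not respect the two products, but it is harmless when the second
  tensor has left factor \<open>1\<close>.
\<close>

lemma tensor_map_mult_right:
  fixes z :: "('a::monoid_add \<times> 'b::monoid_add) vec" and f :: "'a vec \<Rightarrow> 'c::monoid_add vec"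
  assumes "linear_map f"
  shows "tensor_map f id (z * tensor 1 y) = tensor_map f id z * tensor 1 y"
proof (rule linear_map_eqI[where x = z])
  fix p :: "'a \<times> 'b"
  obtain a b where "p = (a, b)" by (cases p)
  then show "tensor_map f id (basis p * tensor 1 y) = tensor_map f id (basis p) * tensor 1 y"
    by (simp add: tensor_map_tensor assms linear_map_id tensor_mult flip: tensor_basis)
qed (intro linear_map_intros)+

lemma linear_map_incl_gamma: "linear_map incl_gamma"
  unfolding incl_gamma_def by (rule linear_map_lin)

lemma delta_gamma_tree_eq: "delta_gamma_tree t = tensor_map incl_gamma id (delta_Y (basis t))"
  by (simp add: delta_gamma_tree_def delta_Y_def tensor_map_tensor_map linear_map_incl_gamma linear_map_id)

lemma Delta_gamma_tree_gamma: "Delta_gamma (tree_gamma t) = tensor_map incl_gamma id (Delta_Y (basis t))"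
proof -
  let ?D = "{(t1, t2). t = over t1 t2}"
  let ?M = "\<lambda>x. tensor_map id mult_map (tensor_assoc (tensor_map delta_gamma sigma x))"
  have linear: "linear_map ?M" "linear_map delta_gamma" "linear_map sigma"
    unfolding delta_gamma_def sigma_def
    by (intro linear_map_intros | rule alg_morphism_linear alg_morphism_gamma_lift)+
  have sigma: "sigma (tree_gamma s) = pi_ab (basis s)" for s
    by (simp add: sigma_def gamma_lift_morphism pi_ab_morphism)
  have summand: "?M (tensor (tree_gamma t1) (tree_gamma t2))
      = tensor_map incl_gamma id (delta_Y (basis t1) * tensor 1 (pi_ab (basis t2)))" for t1 t2
    by (simp only: tensor_map_tensor linear mult_map_tensor_assoc delta_gamma_tree_gamma sigma
        delta_gamma_tree_eq tensor_map_mult_right linear_map_incl_gamma)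
  have "Delta_gamma (tree_gamma t) = ?M (\<Sum>(t1, t2)\<in>?D. tensor (tree_gamma t1) (tree_gamma t2))"
    by (simp add: Delta_gamma_def m_alpha_def Delta_p_gamma_tree_gamma Delta_p_tree_def)
  also have "\<dots> = (\<Sum>(t1, t2)\<in>?D.
      tensor_map incl_gamma id (delta_Y (basis t1) * tensor 1 (pi_ab (basis t2))))"
    unfolding linear_map_sum[OF linear(1)] by (simp add: case_prod_unfold summand)
  also have "\<dots> = tensor_map incl_gamma id (Delta_Y (basis t))"
    unfolding Delta_Y_eq_sum linear_map_sum[OF linear_map_tensor_map] by (simp add: case_prod_unfold)
  finally show ?thesis .
qed

text \<open>
  The left factors of \<open>\<Delta>\<^sub>Y(t)\<close> are combinations of single trees, so this linear form of the preceding
  lemma suffices to apply \<open>\<Delta>\<^sup>\<gamma>\<close> a second time.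
\<close>

lemma Delta_gamma_incl_gamma: "Delta_gamma (incl_gamma x) = tensor_map incl_gamma id (Delta_Y x)"
proof (rule linear_map_eqI[where x = x])
  show "Delta_gamma (incl_gamma (basis t)) = tensor_map incl_gamma id (Delta_Y (basis t))" for t
    using Delta_gamma_tree_gamma[of t] by (simp add: incl_gamma_def)
qed (intro linear_map_intros linear_map_Delta_Y linear_map_incl_gamma
    alg_morphism_Delta_gamma[THEN alg_morphism_linear, THEN linear_map_compose])+

theorem lemma5p9:
  fixes x :: H_gamma
  shows "tensor_assoc (tensor_map Delta_gamma id (Delta_gamma x)) = tensor_map id Delta_alpha (Delta_gamma x)"
proof (rule alg_morphism_eqI_gamma[where x = x])
  fix t
  note lin = linear_map_id alg_morphism_Delta_gamma[THEN alg_morphism_linear]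
    linear_map_Delta_alpha linear_map_incl_gamma linear_map_tensor_map linear_map_Delta_Y
  let ?D = "Delta_Y (basis t)"
  have "tensor_assoc (tensor_map Delta_gamma id (Delta_gamma (tree_gamma t)))
      = tensor_assoc (tensor_map (tensor_map incl_gamma id) id (tensor_map Delta_Y id ?D))"
    by (simp add: Delta_gamma_tree_gamma tensor_map_tensor_map lin Delta_gamma_incl_gamma)
  also have "\<dots> = tensor_map incl_gamma id (tensor_map id Delta_alpha ?D)"
    by (simp only: tensor_assoc_tensor_map linear_map_incl_gamma linear_map_id
        tensor_map_id_id coassociative_trees)
  also have "\<dots> = tensor_map id Delta_alpha (tensor_map incl_gamma id ?D)"
    by (simp add: tensor_map_tensor_map lin)
  finally show "tensor_assoc (tensor_map Delta_gamma id (Delta_gamma (tree_gamma t)))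
      = tensor_map id Delta_alpha (Delta_gamma (tree_gamma t))"
    by (simp only: Delta_gamma_tree_gamma)
qed (intro alg_morphism_intros alg_morphism_Delta_gamma alg_morphism_Delta_alpha
    alg_morphism_Delta_gamma[THEN alg_morphism_compose])+

end
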